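(* Let $T$ be a Kragujevac tree with $t$ branches, where $s_i$ denotes the number of end vertices of $T$ in the $i$-th branch. Then $$DI(T)=\Big(1+\sum_{i=1}^t(2s_i+1)\Big)\big(1+s_1+s_2+\dots+s_t\big).$$
   Context: A dominating set of a finite simple graph $G$ is a set $D\subseteq V(G)$ such that every vertex in $V(G)\setminus D$ is adjacent to some vertex of $D$. A minimal dominating set is a dominating set that does not properly contain any other dominating set. The domination degree of a vertex $a$ is $d_d(a)=\min\{|D| : D \text{ is a minimal dominating set of } G \text{ with } a\in D\}$. The domination index of $G$ is $DI(G)=\sum_{a\in V(G)}d_d(a)$. For $k\ge 1$, let $\mathscr{B}_k$ be the rooted tree obtained from $k$ copies of the path $P_3$ on three vertices, each rooted at one of its end vertices, by identifying their roots; the root of $\mathscr{B}_k$ is the identified vertex (so $\mathscr{B}_k$ has $2k+1$ vertices). Let $t\ge 2$ and $\beta_1,\dots,\beta_t\in\{\mathscr{B}_1,\mathscr{B}_2,\dots\}$. A Kragujevac tree $T$ is the tree consisting of a vertex $a$ of degree $t$ (the central vertex) adjacent to the roots of (disjoint copies of) $\beta_1,\dots,\beta_t$; the $\beta_i$ are called the branches of $T$. Thus $\beta_i=\mathscr{B}_{s_i}$. An end vertex is a vertex of degree 1. *)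

theory Defs
  imports "Graph_Theory.Graph_Theory"
begin

text \<open>
  Finite simple graphs are the \<^locale>\<open>pair_graph\<close>s of the library: an edge \<open>uv\<close> is the pair of
  opposite arcs \<open>(u, v)\<close>, \<open>(v, u)\<close>, so the degree of a vertex is its out-degree.
\<close>

definition dominating_set :: "'a pair_pre_digraph \<Rightarrow> 'a set \<Rightarrow> bool" where
  "dominating_set G D \<longleftrightarrow>
     D \<subseteq> pverts G \<and> (\<forall>v \<in> pverts G - D. \<exists>u \<in> D. (v, u) \<in> parcs G)"

definition minimal_dominating_set :: "'a pair_pre_digraph \<Rightarrow> 'a set \<Rightarrow> bool" where
  "minimal_dominating_set G D \<longleftrightarrow>
     dominating_set G D \<and> (\<nexists>D'. dominating_set G D' \<and> D' \<subset> D)"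

text \<open>
  In a finite simple graph the minimum below is over a finite nonempty set: a maximal independent
  set containing \<open>a\<close> is a minimal dominating set.
\<close>

definition domination_degree :: "'a pair_pre_digraph \<Rightarrow> 'a \<Rightarrow> nat" where
  "domination_degree G a = Min {card D | D. minimal_dominating_set G D \<and> a \<in> D}"

definition domination_index :: "'a pair_pre_digraph \<Rightarrow> nat" where
  "domination_index G = (\<Sum>a \<in> pverts G. domination_degree G a)"

definition end_vertex :: "'a pair_pre_digraph \<Rightarrow> 'a \<Rightarrow> bool" where
  "end_vertex G v \<longleftrightarrow> v \<in> pverts G \<and> out_degree (with_proj G) v = 1"

definition path3 :: "'a \<Rightarrow> 'a \<Rightarrow> 'a \<Rightarrow> 'a pair_pre_digraph" where
  "path3 x y z = \<lparr>pverts = {x, y, z}, parcs = {(x, y), (y, x), (y, z), (z, y)}\<rparr>"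

text \<open>
  \<open>rooted_B k B r\<close>: the graph \<open>B\<close> with root \<open>r\<close> is a copy of \<open>\<B>\<^sub>k\<close>. Identifying the roots of
  disjoint paths is expressed by paths that start at \<open>r\<close> and pairwise share \<open>r\<close> only.
\<close>

definition rooted_B :: "nat \<Rightarrow> 'a pair_pre_digraph \<Rightarrow> 'a \<Rightarrow> bool" where
  "rooted_B k B r \<longleftrightarrow> 1 \<le> k \<and> (\<exists>m l :: nat \<Rightarrow> 'a.
     (\<forall>j \<in> {1..k}. distinct [r, m j, l j]) \<and>
     (\<forall>i \<in> {1..k}. \<forall>j \<in> {1..k}. i \<noteq> j \<longrightarrow>
        pverts (path3 r (m i) (l i)) \<inter> pverts (path3 r (m j) (l j)) = {r}) \<and>
     pverts B = (\<Union>j \<in> {1..k}. pverts (path3 r (m j) (l j))) \<and>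
     parcs B = (\<Union>j \<in> {1..k}. parcs (path3 r (m j) (l j))))"

text \<open>
  \<open>kragujevac_tree T a t \<beta> r\<close>: \<open>T\<close> is a Kragujevac tree with central vertex \<open>a\<close> and branches
  \<open>\<beta> 1, \<dots>, \<beta> t\<close> whose roots are \<open>r 1, \<dots>, r t\<close>. The branches are subgraphs of \<open>T\<close>, so every
  isomorphic copy of such a tree is covered.
\<close>

definition kragujevac_tree ::
  "'a pair_pre_digraph \<Rightarrow> 'a \<Rightarrow> nat \<Rightarrow> (nat \<Rightarrow> 'a pair_pre_digraph) \<Rightarrow> (nat \<Rightarrow> 'a) \<Rightarrow> bool" where
  "kragujevac_tree T a t \<beta> r \<longleftrightarrow> 2 \<le> t \<and>
     (\<forall>i \<in> {1..t}. \<exists>k. rooted_B k (\<beta> i) (r i)) \<and>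
     (\<forall>i \<in> {1..t}. \<forall>j \<in> {1..t}. i \<noteq> j \<longrightarrow> pverts (\<beta> i) \<inter> pverts (\<beta> j) = {}) \<and>
     (\<forall>i \<in> {1..t}. a \<notin> pverts (\<beta> i)) \<and>
     pverts T = insert a (\<Union>i \<in> {1..t}. pverts (\<beta> i)) \<and>
     parcs T = (\<Union>i \<in> {1..t}. parcs (\<beta> i) \<union> {(a, r i), (r i, a)})"

lemma rooted_B_pair_graph:
  assumes "rooted_B k B r"
  shows "pair_graph B" "r \<in> pverts B"
proof -
  from assms obtain m l where k: "1 \<le> k"
    and d: "\<And>j. j \<in> {1..k} \<Longrightarrow> distinct [r, m j, l j]"
    and V: "pverts B = (\<Union>j \<in> {1..k}. pverts (path3 r (m j) (l j)))"
    and E: "parcs B = (\<Union>j \<in> {1..k}. parcs (path3 r (m j) (l j)))"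
    unfolding rooted_B_def by (elim conjE exE) (rule that, (blast | assumption)+)
  have "sym (parcs B)"
    unfolding E by (rule symI) (force simp: path3_def)
  moreover have "fst e \<in> pverts B \<and> snd e \<in> pverts B \<and> fst e \<noteq> snd e" if "e \<in> parcs B" for e
  proof -
    from that obtain j where j: "j \<in> {1..k}" "e \<in> parcs (path3 r (m j) (l j))"
      unfolding E by blast
    from j(2) d[OF j(1)]
    have "fst e \<in> pverts (path3 r (m j) (l j)) \<and> snd e \<in> pverts (path3 r (m j) (l j))
        \<and> fst e \<noteq> snd e"
      by (auto simp: path3_def)
    then show ?thesis unfolding V using j(1) by blast
  qed
  moreover have "finite (pverts B)" "finite (parcs B)"
    unfolding V E by (auto simp: path3_def)
  ultimately show "pair_graph B"
    by unfold_locales (simp_all add: symmetric_def)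
  show "r \<in> pverts B" unfolding V using k by (auto simp: path3_def intro!: bexI[of _ 1])
qed

lemma kragujevac_tree_pair_graph:
  assumes "kragujevac_tree T a t \<beta> r"
  shows "pair_graph T"
proof -
  have V: "pverts T = insert a (\<Union>i \<in> {1..t}. pverts (\<beta> i))"
    and E: "parcs T = (\<Union>i \<in> {1..t}. parcs (\<beta> i) \<union> {(a, r i), (r i, a)})"
    and a: "\<And>i. i \<in> {1..t} \<Longrightarrow> a \<notin> pverts (\<beta> i)"
    and ex: "\<And>i. i \<in> {1..t} \<Longrightarrow> \<exists>k. rooted_B k (\<beta> i) (r i)"
    using assms unfolding kragujevac_tree_def by simp_all
  have B: "pair_graph (\<beta> i)" "r i \<in> pverts (\<beta> i)" if "i \<in> {1..t}" for i
    using ex[OF that] rooted_B_pair_graph by metis+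
  have "sym (parcs T)"
    unfolding E
  proof (intro symI)
    fix u v assume "(u, v) \<in> (\<Union>i \<in> {1..t}. parcs (\<beta> i) \<union> {(a, r i), (r i, a)})"
    then obtain i where i: "i \<in> {1..t}" "(u, v) \<in> parcs (\<beta> i) \<union> {(a, r i), (r i, a)}"
      by blast
    interpret pair_graph "\<beta> i" using B(1)[OF i(1)] .
    have "sym (parcs (\<beta> i))" using pair_sym_arcs by (simp add: symmetric_def)
    then have "(v, u) \<in> parcs (\<beta> i) \<union> {(a, r i), (r i, a)}"
      using i(2) by (auto dest: symD)
    then show "(v, u) \<in> (\<Union>i \<in> {1..t}. parcs (\<beta> i) \<union> {(a, r i), (r i, a)})"
      using i(1) by blast
  qed
  moreover have "fst e \<in> pverts T \<and> snd e \<in> pverts T \<and> fst e \<noteq> snd e" if "e \<in> parcs T" for e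
  proof -
    from that obtain i where i: "i \<in> {1..t}" "e \<in> parcs (\<beta> i) \<union> {(a, r i), (r i, a)}"
      unfolding E by blast
    interpret pair_graph "\<beta> i" using B(1)[OF i(1)] .
    have "fst e \<in> insert a (pverts (\<beta> i)) \<and> snd e \<in> insert a (pverts (\<beta> i)) \<and> fst e \<noteq> snd e"
      using i(2) B(2)[OF i(1)] a[OF i(1)] arc_fst_in_verts arc_snd_in_verts pair_no_loops by auto
    then show ?thesis unfolding V using i(1) by blast
  qed
  moreover have "finite (pverts (\<beta> i))" "finite (parcs (\<beta> i))" if "i \<in> {1..t}" for i
    using B(1)[OF that] pair_fin_digraph.pair_finite_verts pair_fin_digraph.pair_finite_arcs
    unfolding pair_graph_def pair_digraph_def by metis+
  then have "finite (pverts T)" "finite (parcs T)"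
    unfolding V E by auto
  ultimately show ?thesis
    by unfold_locales (simp_all add: symmetric_def)
qed

end

theory Submission
  imports Defs
begin

text \<open>
  All domination degrees of a Kragujevac tree equal its domination number, so the index is the
  number of vertices times that number. Write each branch as a root with \<^emph>\<open>legs\<close> consisting of a
  middle vertex and an end vertex, and let \<open>S\<close> be the total number of legs.

  No dominating set has fewer than \<open>1 + S\<close> vertices: the central vertex together with the \<open>S\<close> end
  vertices of the legs is a packing, that is, the closed neighbourhoods of these vertices are
  pairwise disjoint, and a dominating set meets each of them (\<open>packing_le_dominating\<close>). Conversely
  every vertex lies in a dominating set of size exactly \<open>1 + S\<close>. Take the central vertex and all
  middle vertices, or the central vertex and all end vertices, or one root and all middle vertices;
  in the last case the other roots are dominated because every branch has a leg. A dominating set of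
  the least possible size is minimal, so these sets realise the domination degrees
  (\<open>domination_degree_eq_packing\<close>). Finally \<open>S\<close> is the sum of the \<open>s\<^sub>i\<close>, since the vertices of
  degree one are exactly the end vertices of the legs.
\<close>

section \<open>Packings bound domination degrees\<close>

definition closed_neighbourhood :: "'a pair_pre_digraph \<Rightarrow> 'a \<Rightarrow> 'a set" where
  "closed_neighbourhood G v = insert v {u. (v, u) \<in> parcs G}"

text \<open>
  Choosing for each vertex of the packing a dominating vertex in its closed neighbourhood is
  injective.
\<close>

lemma packing_le_dominating:
  assumes "dominating_set G D" and "finite D" and "P \<subseteq> pverts G"
    and packing: "\<And>u v. u \<in> P \<Longrightarrow> v \<in> P \<Longrightarrow> u \<noteq> v \<Longrightarrow>
      closed_neighbourhood G u \<inter> closed_neighbourhood G v = {}"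
  shows "card P \<le> card D"
proof -
  have "\<forall>v \<in> P. \<exists>u. u \<in> D \<inter> closed_neighbourhood G v"
    using assms(1,3) unfolding dominating_set_def closed_neighbourhood_def by blast
  then obtain f where f: "\<And>v. v \<in> P \<Longrightarrow> f v \<in> D \<inter> closed_neighbourhood G v"
    by (metis (no_types))
  have "inj_on f P"
    by (rule inj_onI) (metis IntE IntI empty_iff f packing)
  moreover have "f ` P \<subseteq> D"
    using f by blast
  ultimately show ?thesis
    using \<open>finite D\<close> by (rule card_inj_on_le)
qed

text \<open>
  A dominating set that is as small as a packing cannot properly contain another one, so it is a
  minimal dominating set, and none of the competitors in the definition of the domination degree
  is smaller.
\<close>

lemma domination_degree_eq_packing:
  assumes fin: "finite (pverts G)" and P: "P \<subseteq> pverts G"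
    and packing: "\<And>u v. u \<in> P \<Longrightarrow> v \<in> P \<Longrightarrow> u \<noteq> v \<Longrightarrow>
      closed_neighbourhood G u \<inter> closed_neighbourhood G v = {}"
    and D: "dominating_set G D" "card D = card P" "v \<in> D"
  shows "domination_degree G v = card P"
proof -
  have sub: "D' \<subseteq> pverts G" if "dominating_set G D'" for D'
    using that by (simp add: dominating_set_def)
  have lower: "card P \<le> card D'" if "dominating_set G D'" for D'
    using packing_le_dominating[OF that finite_subset[OF sub[OF that] fin] P packing] .
  have "\<not> D' \<subset> D" if "dominating_set G D'" for D'
  proof
    assume "D' \<subset> D"
    with finite_subset[OF sub[OF D(1)] fin] have "card D' < card D"
      by (rule psubset_card_mono)
    with lower[OF that] D(2) show False by simp
  qed
  then have min: "minimal_dominating_set G D"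
    using D(1) unfolding minimal_dominating_set_def by blast
  let ?C = "{card D | D. minimal_dominating_set G D \<and> v \<in> D}"
  have "?C \<subseteq> card ` Pow (pverts G)"
    using sub unfolding minimal_dominating_set_def by blast
  then have "finite ?C"
    by (rule finite_subset) (simp add: fin)
  moreover have "card P \<le> n" if "n \<in> ?C" for n
    using that lower unfolding minimal_dominating_set_def by blast
  moreover have "card P \<in> ?C"
    using min D(2)[symmetric] D(3) by blast
  ultimately show ?thesis
    unfolding domination_degree_def by (rule Min_eqI)
qed

section \<open>Kragujevac trees in coordinates\<close>

text \<open>
  The branches are indexed by \<open>I\<close> and all legs of all branches together by \<open>J\<close>; leg \<open>p\<close> belongs to
  branch \<open>b p\<close> and has middle vertex \<open>m p\<close> and end vertex \<open>l p\<close>. One index set for all legs keeps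
  the counting free of nested unions, and that each branch has a leg becomes surjectivity of \<open>b\<close>.
\<close>

locale kragujevac_coordinates =
  fixes T :: "'a pair_pre_digraph" and a :: 'a
    and I :: "'i set" and r :: "'i \<Rightarrow> 'a"
    and J :: "'j set" and b :: "'j \<Rightarrow> 'i" and m l :: "'j \<Rightarrow> 'a"
  assumes finite_I: "finite I" and finite_J: "finite J"
    and two_branches: "2 \<le> card I" and legs: "b ` J = I"
    and verts: "pverts T = insert a (r ` I \<union> m ` J \<union> l ` J)"
    and arcs: "parcs T = (\<Union>i\<in>I. {(a, r i), (r i, a)}) \<union>
      (\<Union>p\<in>J. {(r (b p), m p), (m p, r (b p)), (m p, l p), (l p, m p)})"
    and inj_r: "inj_on r I" and inj_m: "inj_on m J" and inj_l: "inj_on l J"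
    and a_notin: "a \<notin> r ` I" "a \<notin> m ` J" "a \<notin> l ` J"
    and disj: "r ` I \<inter> m ` J = {}" "r ` I \<inter> l ` J = {}" "m ` J \<inter> l ` J = {}"
begin

lemma finite_verts: "finite (pverts T)"
  by (simp add: verts finite_I finite_J)

lemma card_verts: "card (pverts T) = 1 + card I + 2 * card J"
proof -
  have "card (r ` I \<union> m ` J \<union> l ` J) = card I + card J + card J"
    using disj inj_r inj_m inj_l
    by (simp add: card_Un_disjoint finite_I finite_J card_image Int_Un_distrib2)
  then show ?thesis
    using a_notin by (simp add: verts finite_I finite_J)
qed

lemma nbh_centre: "(a, u) \<in> parcs T \<longleftrightarrow> u \<in> r ` I"
  using a_notin legs unfolding arcs by auto

lemma nbh_end:
  assumes "p \<in> J"
  shows "(l p, u) \<in> parcs T \<longleftrightarrow> u = m p"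
proof
  assume "(l p, u) \<in> parcs T"
  then consider i where "i \<in> I" "l p = a \<or> l p = r i"
    | q where "q \<in> J" "l p = r (b q) \<or> l p = m q"
    | q where "q \<in> J" "l p = l q" "u = m q"
    unfolding arcs by blast
  then show "u = m p"
  proof cases
    case 1
    then show ?thesis using assms a_notin disj by blast
  next
    case 2
    then show ?thesis using assms disj legs by blast
  next
    case 3
    then show ?thesis using assms inj_l by (auto dest: inj_onD)
  qed
next
  assume "u = m p"
  then show "(l p, u) \<in> parcs T"
    using assms unfolding arcs by blast
qed

subsection \<open>The end vertices\<close>

lemma not_end_vertex:
  assumes "(v, u) \<in> parcs T" "(v, w) \<in> parcs T" "u \<noteq> w"
  shows "\<not> end_vertex T v"
proof
  assume "end_vertex T v"
  then have "card {e \<in> parcs T. fst e = v} = 1"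
    by (simp add: end_vertex_def out_degree_def out_arcs_def)
  then obtain e where e: "{e \<in> parcs T. fst e = v} = {e}"
    by (auto simp: card_1_singleton_iff)
  moreover have "(v, u) \<in> {e \<in> parcs T. fst e = v}" "(v, w) \<in> {e \<in> parcs T. fst e = v}"
    using assms by auto
  ultimately show False using \<open>u \<noteq> w\<close> by auto
qed

text \<open>
  A centre with at least two branches, a root with at least one leg and a middle vertex all have
  two neighbours.
\<close>

lemma end_vertex_iff: "end_vertex T v \<longleftrightarrow> v \<in> l ` J"
proof
  assume end_v: "end_vertex T v"
  then have "v \<in> pverts T" by (simp add: end_vertex_def)
  then consider "v = a" | i where "i \<in> I" "v = r i" | p where "p \<in> J" "v = m p" | "v \<in> l ` J"
    unfolding verts by blast
  then show "v \<in> l ` J"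
  proof cases
    case 1
    have "\<not> card I \<le> Suc 0" using two_branches by simp
    then obtain i i' where i: "i \<in> I" "i' \<in> I" "i \<noteq> i'"
      using card_le_Suc0_iff_eq[OF finite_I] by blast
    then have "r i \<noteq> r i'" using inj_r by (auto dest: inj_onD)
    with 1 i not_end_vertex[of a "r i" "r i'"] end_v show ?thesis
      by (simp add: nbh_centre)
  next
    case 2
    then obtain p where p: "p \<in> J" "i = b p" using legs by blast
    have "(r i, a) \<in> parcs T" "(r i, m p) \<in> parcs T" "a \<noteq> m p"
      using 2 p a_notin unfolding arcs by blast+
    with not_end_vertex 2 end_v show ?thesis by blast
  next
    case 3
    have "(m p, r (b p)) \<in> parcs T" "(m p, l p) \<in> parcs T"
      using 3 unfolding arcs by blast+
    moreover have "r (b p) \<noteq> l p"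
      using 3 disj legs by blast
    ultimately show ?thesis using not_end_vertex 3 end_v by blast
  next
    case 4
    then show ?thesis .
  qed
next
  assume "v \<in> l ` J"
  then obtain p where p: "p \<in> J" "v = l p" by blast
  have "{e \<in> parcs T. fst e = v} = {(v, m p)}"
    unfolding p(2) using nbh_end[OF p(1)] by force
  moreover have "v \<in> pverts T"
    using p unfolding verts by blast
  ultimately show "end_vertex T v"
    by (simp add: end_vertex_def out_degree_def out_arcs_def)
qed

subsection \<open>A packing and dominating sets of the same size\<close>

lemma packing:
  assumes "u \<in> insert a (l ` J)" "v \<in> insert a (l ` J)" "u \<noteq> v"
  shows "closed_neighbourhood T u \<inter> closed_neighbourhood T v = {}"
proof -
  have centre: "closed_neighbourhood T a = insert a (r ` I)"
    by (auto simp: closed_neighbourhood_def nbh_centre)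
  have leaf: "closed_neighbourhood T (l p) = {l p, m p}" if "p \<in> J" for p
    using that by (auto simp: closed_neighbourhood_def nbh_end)
  have centre_leaf: "closed_neighbourhood T a \<inter> closed_neighbourhood T (l p) = {}"
    if "p \<in> J" for p
    using that a_notin disj by (auto simp: centre leaf)
  have leaf_leaf: "closed_neighbourhood T (l p) \<inter> closed_neighbourhood T (l q) = {}"
    if "p \<in> J" "q \<in> J" "p \<noteq> q" for p q
    using that disj inj_onD[OF inj_l] inj_onD[OF inj_m] by (auto simp: leaf)
  show ?thesis
    using assms centre_leaf leaf_leaf by blast
qed

lemma card_packing: "card (insert a (l ` J)) = 1 + card J"
  using a_notin inj_l finite_J by (simp add: card_image)

lemma dominating_setI:
  assumes "D \<subseteq> pverts T"
    and "a \<in> D \<or> (\<exists>u \<in> D. (a, u) \<in> parcs T)"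
    and "\<And>i. i \<in> I \<Longrightarrow> r i \<in> D \<or> (\<exists>u \<in> D. (r i, u) \<in> parcs T)"
    and "\<And>p. p \<in> J \<Longrightarrow> m p \<in> D \<or> (\<exists>u \<in> D. (m p, u) \<in> parcs T)"
    and "\<And>p. p \<in> J \<Longrightarrow> l p \<in> D \<or> (\<exists>u \<in> D. (l p, u) \<in> parcs T)"
  shows "dominating_set T D"
  unfolding dominating_set_def
proof (intro conjI ballI)
  fix v assume v: "v \<in> pverts T - D"
  then consider "v = a" | i where "i \<in> I" "v = r i" | p where "p \<in> J" "v = m p"
    | p where "p \<in> J" "v = l p"
    unfolding verts by blast
  then show "\<exists>u \<in> D. (v, u) \<in> parcs T"
    by cases (use v assms(2-5) in blast)+
qed (rule assms(1))

text \<open>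
  The centre dominates all roots, and the two outer vertices of a leg dominate each other, so that
  either of them will do.
\<close>

lemma dominating_centre:
  assumes "D \<subseteq> pverts T" "a \<in> D" and "\<And>p. p \<in> J \<Longrightarrow> m p \<in> D \<or> l p \<in> D"
  shows "dominating_set T D"
proof (rule dominating_setI)
  show "r i \<in> D \<or> (\<exists>u \<in> D. (r i, u) \<in> parcs T)" if "i \<in> I" for i
    using that assms(2) unfolding arcs by blast
  fix p assume p: "p \<in> J"
  then have "(m p, l p) \<in> parcs T" "(l p, m p) \<in> parcs T"
    unfolding arcs by blast+
  then show "m p \<in> D \<or> (\<exists>u \<in> D. (m p, u) \<in> parcs T)"
    and "l p \<in> D \<or> (\<exists>u \<in> D. (l p, u) \<in> parcs T)"
    using assms(3)[OF p] by blast+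
qed (use assms in auto)

lemma dominating_centre_middles: "dominating_set T (insert a (m ` J))"
  by (rule dominating_centre) (auto simp: verts)

lemma dominating_centre_ends: "dominating_set T (insert a (l ` J))"
  by (rule dominating_centre) (auto simp: verts)

lemma dominating_root_middles:
  assumes "i \<in> I"
  shows "dominating_set T (insert (r i) (m ` J))" (is "dominating_set T ?D")
proof (rule dominating_setI)
  show "?D \<subseteq> pverts T"
    using assms by (auto simp: verts)
  have "(a, r i) \<in> parcs T"
    using assms by (simp add: nbh_centre)
  then show "a \<in> ?D \<or> (\<exists>u \<in> ?D. (a, u) \<in> parcs T)"
    by blast
  show "r i' \<in> ?D \<or> (\<exists>u \<in> ?D. (r i', u) \<in> parcs T)" if "i' \<in> I" for i'
  proof -
    obtain p where p: "p \<in> J" "i' = b p"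
      using \<open>i' \<in> I\<close> legs by blast
    then have "(r i', m p) \<in> parcs T"
      unfolding arcs by blast
    with p show ?thesis by blast
  qed
  show "l p \<in> ?D \<or> (\<exists>u \<in> ?D. (l p, u) \<in> parcs T)" if "p \<in> J" for p
    using that by (simp add: nbh_end)
qed blast

lemma ex_small_dominating:
  assumes "v \<in> pverts T"
  shows "\<exists>D. dominating_set T D \<and> card D = 1 + card J \<and> v \<in> D"
proof -
  have card_centre: "card (insert a (m ` J)) = 1 + card J"
    using a_notin inj_m finite_J by (simp add: card_image)
  have card_root: "card (insert (r i) (m ` J)) = 1 + card J" if "i \<in> I" for i
  proof -
    have "r i \<notin> m ` J" using that disj by blast
    then show ?thesis using inj_m finite_J by (simp add: card_image)
  qed
  consider "v \<in> insert a (m ` J)" | i where "i \<in> I" "v = r i" | "v \<in> l ` J"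
    using assms unfolding verts by blast
  then show ?thesis
  proof cases
    case 1
    then show ?thesis using dominating_centre_middles card_centre by blast
  next
    case 2
    then show ?thesis using dominating_root_middles card_root by blast
  next
    case 3
    then show ?thesis using dominating_centre_ends card_packing by blast
  qed
qed

lemma domination_index_eq: "domination_index T = (1 + card I + 2 * card J) * (1 + card J)"
proof -
  have P: "insert a (l ` J) \<subseteq> pverts T" unfolding verts by blast
  have "domination_degree T v = 1 + card J" if v: "v \<in> pverts T" for v
  proof -
    from ex_small_dominating[OF v] obtain D
      where D: "dominating_set T D" "card D = 1 + card J" "v \<in> D" by blast
    have "card D = card (insert a (l ` J))"
      unfolding D(2) card_packing ..
    from domination_degree_eq_packing[OF finite_verts P packing D(1) this D(3)]
    show ?thesis unfolding card_packing .
  qed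
  then have "domination_index T = (\<Sum>v\<in>pverts T. 1 + card J)"
    unfolding domination_index_def by (rule sum.cong[OF refl])
  then show ?thesis
    unfolding sum_constant card_verts by simp
qed

end

section \<open>Introducing the coordinates\<close>

text \<open>
  The paths of \<open>\<B>\<^sub>k\<close> pairwise share the root only; here this is turned into injectivity and
  disjointness, which can be combined over the branches.
\<close>

definition leg_coordinates ::
  "nat \<Rightarrow> 'a pair_pre_digraph \<Rightarrow> 'a \<Rightarrow> (nat \<Rightarrow> 'a) \<Rightarrow> (nat \<Rightarrow> 'a) \<Rightarrow> bool" where
  "leg_coordinates k B r m l \<longleftrightarrow>
     inj_on m {1..k} \<and> inj_on l {1..k} \<and> r \<notin> m ` {1..k} \<and> r \<notin> l ` {1..k} \<and>
     m ` {1..k} \<inter> l ` {1..k} = {} \<and>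
     pverts B = insert r (m ` {1..k} \<union> l ` {1..k}) \<and>
     parcs B = (\<Union>j\<in>{1..k}. {(r, m j), (m j, r), (m j, l j), (l j, m j)})"

lemma rooted_B_leg_coordinates:
  assumes "rooted_B k B r"
  shows "\<exists>m l. leg_coordinates k B r m l"
proof -
  from assms obtain m l where k: "1 \<le> k"
    and d: "\<And>j. j \<in> {1..k} \<Longrightarrow> distinct [r, m j, l j]"
    and share: "\<And>i j. i \<in> {1..k} \<Longrightarrow> j \<in> {1..k} \<Longrightarrow> i \<noteq> j \<Longrightarrow>
        pverts (path3 r (m i) (l i)) \<inter> pverts (path3 r (m j) (l j)) = {r}"
    and V: "pverts B = (\<Union>j \<in> {1..k}. pverts (path3 r (m j) (l j)))"
    and E: "parcs B = (\<Union>j \<in> {1..k}. parcs (path3 r (m j) (l j)))"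
    unfolding rooted_B_def by (elim conjE exE) (rule that, (blast | assumption)+)
  have sep: "{m i, l i} \<inter> {m j, l j} = {}" if "i \<in> {1..k}" "j \<in> {1..k}" "i \<noteq> j" for i j
    using share[OF that] d[OF that(1)] d[OF that(2)] by (auto simp: path3_def)
  have "leg_coordinates k B r m l"
    unfolding leg_coordinates_def
  proof (intro conjI)
    show "inj_on m {1..k}" "inj_on l {1..k}"
      using sep by (auto intro!: inj_onI) blast+
    have "r \<noteq> m j" "r \<noteq> l j" if "j \<in> {1..k}" for j
      using d[OF that] by simp_all
    then show "r \<notin> m ` {1..k}" "r \<notin> l ` {1..k}"
      by blast+
    show "m ` {1..k} \<inter> l ` {1..k} = {}"
    proof -
      have "m i \<noteq> l j" if "i \<in> {1..k}" "j \<in> {1..k}" for i j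
        using sep[OF that] d[OF that(1)] by (cases "i = j") auto
      then show ?thesis by blast
    qed
    show "pverts B = insert r (m ` {1..k} \<union> l ` {1..k})"
      using k unfolding V path3_def by auto
    show "parcs B = (\<Union>j\<in>{1..k}. {(r, m j), (m j, r), (m j, l j), (l j, m j)})"
      unfolding E path3_def by auto
  qed
  then show ?thesis by blast
qed

lemma rooted_B_positive: "rooted_B k B r \<Longrightarrow> 1 \<le> k"
  by (simp add: rooted_B_def)

text \<open>
  Branches are pairwise disjoint and avoid the centre, so the coordinates of the single branches
  combine without collisions. The second claim locates the end vertices of one branch; it ties the
  global coordinates to the numbers \<open>s\<^sub>i\<close>.
\<close>

lemma kragujevac_tree_coordinates:
  fixes T :: "'a pair_pre_digraph"
  assumes "kragujevac_tree T a t \<beta> r"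
  obtains k :: "nat \<Rightarrow> nat" and m l :: "nat \<times> nat \<Rightarrow> 'a" where
    "kragujevac_coordinates T a {1..t} r (SIGMA i:{1..t}. {1..k i}) fst m l"
    "\<And>i. i \<in> {1..t} \<Longrightarrow>
       pverts (\<beta> i) \<inter> l ` (SIGMA i:{1..t}. {1..k i}) = (\<lambda>j. l (i, j)) ` {1..k i}"
proof -
  have t: "2 \<le> t"
    and ex: "\<And>i. i \<in> {1..t} \<Longrightarrow> \<exists>k. rooted_B k (\<beta> i) (r i)"
    and dj: "\<And>i j. i \<in> {1..t} \<Longrightarrow> j \<in> {1..t} \<Longrightarrow> i \<noteq> j \<Longrightarrow> pverts (\<beta> i) \<inter> pverts (\<beta> j) = {}"
    and a: "\<And>i. i \<in> {1..t} \<Longrightarrow> a \<notin> pverts (\<beta> i)"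
    and V: "pverts T = insert a (\<Union>i \<in> {1..t}. pverts (\<beta> i))"
    and E: "parcs T = (\<Union>i \<in> {1..t}. parcs (\<beta> i) \<union> {(a, r i), (r i, a)})"
    using assms unfolding kragujevac_tree_def by simp_all
  obtain k where k: "\<And>i. i \<in> {1..t} \<Longrightarrow> rooted_B (k i) (\<beta> i) (r i)"
    using ex by metis
  obtain m l where "\<And>i. i \<in> {1..t} \<Longrightarrow> leg_coordinates (k i) (\<beta> i) (r i) (m i) (l i)"
    using rooted_B_leg_coordinates[OF k] by metis
  then have
    inj_m: "\<And>i. i \<in> {1..t} \<Longrightarrow> inj_on (m i) {1..k i}" and
    inj_l: "\<And>i. i \<in> {1..t} \<Longrightarrow> inj_on (l i) {1..k i}" and
    rm: "\<And>i. i \<in> {1..t} \<Longrightarrow> r i \<notin> m i ` {1..k i}" and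
    rl: "\<And>i. i \<in> {1..t} \<Longrightarrow> r i \<notin> l i ` {1..k i}" and
    ml: "\<And>i. i \<in> {1..t} \<Longrightarrow> m i ` {1..k i} \<inter> l i ` {1..k i} = {}" and
    VB: "\<And>i. i \<in> {1..t} \<Longrightarrow> pverts (\<beta> i) = insert (r i) (m i ` {1..k i} \<union> l i ` {1..k i})" and
    EB: "\<And>i. i \<in> {1..t} \<Longrightarrow> parcs (\<beta> i) =
      (\<Union>j\<in>{1..k i}. {(r i, m i j), (m i j, r i), (m i j, l i j), (l i j, m i j)})"
    unfolding leg_coordinates_def by blast+
  let ?J = "SIGMA i:{1..t}. {1..k i}"
  have r_in: "r i \<in> pverts (\<beta> i)" if "i \<in> {1..t}" for i
    using VB[OF that] by blast
  have m_in: "m i j \<in> pverts (\<beta> i)" and l_in: "l i j \<in> pverts (\<beta> i)"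
    if "i \<in> {1..t}" "j \<in> {1..k i}" for i j
    using VB[OF that(1)] that(2) by blast+
  have same: "i = i'" if "v \<in> pverts (\<beta> i)" "v \<in> pverts (\<beta> i')" "i \<in> {1..t}" "i' \<in> {1..t}"
    for v i i'
    using that dj by blast
  have coord: "kragujevac_coordinates T a {1..t} r ?J fst (case_prod m) (case_prod l)"
  proof
    show "fst ` ?J = {1..t}"
      using k rooted_B_positive by (force simp: image_iff)
    show "pverts T = insert a (r ` {1..t} \<union> case_prod m ` ?J \<union> case_prod l ` ?J)"
      unfolding V using VB by (auto simp: image_iff)
    show "parcs T = (\<Union>i\<in>{1..t}. {(a, r i), (r i, a)}) \<union> (\<Union>p\<in>?J. {(r (fst p), case_prod m p),
        (case_prod m p, r (fst p)), (case_prod m p, case_prod l p), (case_prod l p, case_prod m p)})"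
    proof -
      have "parcs T = (\<Union>i\<in>{1..t}. {(a, r i), (r i, a)}) \<union> (\<Union>i\<in>{1..t}. parcs (\<beta> i))"
        unfolding E by blast
      also have "(\<Union>i\<in>{1..t}. parcs (\<beta> i)) = (\<Union>i\<in>{1..t}. \<Union>j\<in>{1..k i}.
          {(r i, m i j), (m i j, r i), (m i j, l i j), (l i j, m i j)})"
        using EB by simp
      also have "\<dots> = (\<Union>p\<in>?J. {(r (fst p), case_prod m p), (case_prod m p, r (fst p)),
          (case_prod m p, case_prod l p), (case_prod l p, case_prod m p)})"
        by (simp add: Sigma_def)
      finally show ?thesis .
    qed
    show "inj_on r {1..t}"
      by (rule inj_onI) (metis r_in same)
    show "inj_on (case_prod m) ?J"
    proof (rule inj_onI, clarify)
      fix i j i' j'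
      assume *: "i \<in> {1..t}" "j \<in> {1..k i}" "i' \<in> {1..t}" "j' \<in> {1..k i'}" "m i j = m i' j'"
      then have "i = i'" using m_in same by metis
      with * inj_onD[OF inj_m[OF *(1)]] show "i = i' \<and> j = j'" by simp
    qed
    show "inj_on (case_prod l) ?J"
    proof (rule inj_onI, clarify)
      fix i j i' j'
      assume *: "i \<in> {1..t}" "j \<in> {1..k i}" "i' \<in> {1..t}" "j' \<in> {1..k i'}" "l i j = l i' j'"
      then have "i = i'" using l_in same by metis
      with * inj_onD[OF inj_l[OF *(1)]] show "i = i' \<and> j = j'" by simp
    qed
    show "a \<notin> r ` {1..t}" "a \<notin> case_prod m ` ?J" "a \<notin> case_prod l ` ?J"
      using a r_in m_in l_in by fastforce+
    have "r i \<noteq> m i' j" "r i \<noteq> l i' j"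
      if "i \<in> {1..t}" "i' \<in> {1..t}" "j \<in> {1..k i'}" for i i' j
      using that rm rl r_in m_in l_in same by (metis imageI)+
    then show "r ` {1..t} \<inter> case_prod m ` ?J = {}" "r ` {1..t} \<inter> case_prod l ` ?J = {}"
      by fastforce+
    have "m i j \<noteq> l i' j'"
      if "i \<in> {1..t}" "j \<in> {1..k i}" "i' \<in> {1..t}" "j' \<in> {1..k i'}" for i j i' j'
    proof
      assume eq: "m i j = l i' j'"
      then have "i = i'" using that m_in l_in same by metis
      then show False using eq that ml by blast
    qed
    then show "case_prod m ` ?J \<inter> case_prod l ` ?J = {}"
      by fastforce
  qed (use t in auto)
  have "pverts (\<beta> i) \<inter> case_prod l ` ?J = (\<lambda>j. case_prod l (i, j)) ` {1..k i}"
    if i: "i \<in> {1..t}" for i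
  proof (intro equalityI subsetI)
    fix v assume "v \<in> pverts (\<beta> i) \<inter> case_prod l ` ?J"
    then obtain i' j where ij: "i' \<in> {1..t}" "j \<in> {1..k i'}" "v = l i' j" "v \<in> pverts (\<beta> i)"
      by force
    then have "i' = i" using l_in same i by metis
    with ij show "v \<in> (\<lambda>j. case_prod l (i, j)) ` {1..k i}" by auto
  next
    fix v assume "v \<in> (\<lambda>j. case_prod l (i, j)) ` {1..k i}"
    then show "v \<in> pverts (\<beta> i) \<inter> case_prod l ` ?J"
      using i l_in by force
  qed
  with coord show thesis by (rule that)
qed

theorem proposition4p15:
  fixes T :: "'a pair_pre_digraph" and a :: 'a and t :: nat
    and \<beta> :: "nat \<Rightarrow> 'a pair_pre_digraph" and r :: "nat \<Rightarrow> 'a" and s :: "nat \<Rightarrow> nat"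
  assumes "kragujevac_tree T a t \<beta> r"
    and "\<And>i. i \<in> {1..t} \<Longrightarrow> s i = card {v \<in> pverts (\<beta> i). end_vertex T v}"
  shows "domination_index T = (1 + (\<Sum>i = 1..t. (2 * s i + 1))) * (1 + (\<Sum>i = 1..t. s i))"
proof -
  obtain k :: "nat \<Rightarrow> nat" and m l where
    coord: "kragujevac_coordinates T a {1..t} r (SIGMA i:{1..t}. {1..k i}) fst m l"
    and ends: "\<And>i. i \<in> {1..t} \<Longrightarrow>
      pverts (\<beta> i) \<inter> l ` (SIGMA i:{1..t}. {1..k i}) = (\<lambda>j. l (i, j)) ` {1..k i}"
    by (rule kragujevac_tree_coordinates[OF assms(1)]) (rule that)
  interpret kragujevac_coordinates T a "{1..t}" r "SIGMA i:{1..t}. {1..k i}" fst m l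
    by (rule coord)
  have "s i = k i" if i: "i \<in> {1..t}" for i
  proof -
    have "{v \<in> pverts (\<beta> i). end_vertex T v} = (\<lambda>j. l (i, j)) ` {1..k i}"
      using ends[OF i] by (auto simp: end_vertex_iff)
    moreover have "inj_on (\<lambda>j. l (i, j)) {1..k i}"
      using i by (auto intro!: inj_onI dest: inj_onD[OF inj_l])
    ultimately show ?thesis
      using assms(2)[OF i] by (simp add: card_image)
  qed
  then have "card (SIGMA i:{1..t}. {1..k i}) = (\<Sum>i = 1..t. s i)"
    by simp
  moreover have "(\<Sum>i = 1..t. (2 * s i + 1)) = t + 2 * (\<Sum>i = 1..t. s i)"
    unfolding sum.distrib by (simp add: sum_distrib_left)
  ultimately show ?thesis
    using domination_index_eq by simp
qed

end
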